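(* Let $X$ be a strongly $0$-dimensional metrizable space. Then the set $\mathrm{GL}(X)$ is comeager in the space $(\mathrm{Met}(X), \mathcal{D}_{X})$.
   Context: A topological space $X$ is strongly $0$-dimensional if for every pair $A, B$ of disjoint closed subsets of $X$ there exists a clopen set $V$ with $A\subset V$ and $V\cap B=\emptyset$. For a metrizable space $X$, $\mathrm{Met}(X)$ denotes the set of all metrics on $X$ that generate the given topology of $X$. The function $\mathcal{D}_{X}(d,e)=\sup_{x,y\in X}|d(x,y)-e(x,y)|\in[0,\infty]$ is a $[0,\infty]$-valued metric on $\mathrm{Met}(X)$, and $\mathrm{Met}(X)$ carries the topology generated by its open balls. A metric $d$ on $X$ is gap-like if for every $p\in X$ the set $\{d(p,x)\mid x\in X\}$ is not dense in any neighborhood of $0$ in $[0,\infty)$. $\mathrm{GL}(X)$ is the set of all gap-like metrics in $\mathrm{Met}(X)$. A subset of a topological space is meager if it is a countable union of nowhere dense subsets, and comeager if its complement is meager. *)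

theory Defs
  imports "HOL-Analysis.Analysis"
begin

definition strongly_zero_dimensional :: "'a topology \<Rightarrow> bool" where
  "strongly_zero_dimensional X \<longleftrightarrow>
     (\<forall>A B. closedin X A \<and> closedin X B \<and> A \<inter> B = {} \<longrightarrow>
        (\<exists>V. openin X V \<and> closedin X V \<and> A \<subseteq> V \<and> V \<inter> B = {}))"

text \<open>A metric on the carrier \<open>topspace X\<close> is represented by a function that vanishes
  outside the carrier, so that distinct elements of \<open>Met X\<close> are distinct metrics on \<open>X\<close>.
  The value \<open>0\<close> is chosen because \<open>Metric_space\<close> requires nonnegativity
  and symmetry on the whole type.\<close>

definition Met :: "'a topology \<Rightarrow> ('a \<Rightarrow> 'a \<Rightarrow> real) set" where
  "Met X = {d. Metric_space (topspace X) d \<and> Metric_space.mtopology (topspace X) d = X \<and>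
               (\<forall>x y. x \<notin> topspace X \<or> y \<notin> topspace X \<longrightarrow> d x y = 0)}"

text \<open>The supremum is taken in \<open>ennreal\<close>, so it may be infinite, and it is \<open>0\<close> for the
  empty space.\<close>

definition Met_dist ::
    "'a topology \<Rightarrow> ('a \<Rightarrow> 'a \<Rightarrow> real) \<Rightarrow> ('a \<Rightarrow> 'a \<Rightarrow> real) \<Rightarrow> ennreal" where
  "Met_dist X d e = (SUP (x, y) \<in> topspace X \<times> topspace X. ennreal \<bar>d x y - e x y\<bar>)"

definition Met_topology :: "'a topology \<Rightarrow> ('a \<Rightarrow> 'a \<Rightarrow> real) topology" where
  "Met_topology X =
     topology_generated_by {{e \<in> Met X. Met_dist X d e < r} | d r. d \<in> Met X \<and> 0 < r}"

lemma topspace_Met_topology: "topspace (Met_topology X) = Met X"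
proof -
  have "d \<in> {e \<in> Met X. Met_dist X d e < 1}" if "d \<in> Met X" for d
  proof -
    have "Met_dist X d d \<le> 0"
      unfolding Met_dist_def by (rule SUP_least) auto
    then show ?thesis
      using that by simp
  qed
  moreover have "(0::ennreal) < 1" by simp
  ultimately show ?thesis
    unfolding Met_topology_def topology_generated_by_topspace by blast
qed

definition dense_within :: "'a topology \<Rightarrow> 'a set \<Rightarrow> 'a set \<Rightarrow> bool" where
  "dense_within T S U \<longleftrightarrow> U \<subseteq> T closure_of (S \<inter> U)"

text \<open>Neighborhoods are sets containing an open set around the point; they need not be open.\<close>

definition nbhd_in :: "'a topology \<Rightarrow> 'a \<Rightarrow> 'a set \<Rightarrow> bool" where
  "nbhd_in T a U \<longleftrightarrow> U \<subseteq> topspace T \<and> (\<exists>W. openin T W \<and> a \<in> W \<and> W \<subseteq> U)"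

definition gap_like :: "'a topology \<Rightarrow> ('a \<Rightarrow> 'a \<Rightarrow> real) \<Rightarrow> bool" where
  "gap_like X d \<longleftrightarrow>
     (\<forall>p \<in> topspace X. \<forall>U. nbhd_in (top_of_set {0..}) 0 U \<longrightarrow>
        \<not> dense_within (top_of_set {0..}) {d p x | x. x \<in> topspace X} U)"

definition GL :: "'a topology \<Rightarrow> ('a \<Rightarrow> 'a \<Rightarrow> real) set" where
  "GL X = {d \<in> Met X. gap_like X d}"

definition nowhere_dense_in :: "'a topology \<Rightarrow> 'a set \<Rightarrow> bool" where
  "nowhere_dense_in T S \<longleftrightarrow> S \<subseteq> topspace T \<and> T interior_of (T closure_of S) = {}"

definition meager_in :: "'a topology \<Rightarrow> 'a set \<Rightarrow> bool" where
  "meager_in T S \<longleftrightarrow> (\<exists>\<F>. countable \<F> \<and> (\<forall>F \<in> \<F>. nowhere_dense_in T F) \<and> S = \<Union>\<F>)"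

definition comeager_in :: "'a topology \<Rightarrow> 'a set \<Rightarrow> bool" where
  "comeager_in T S \<longleftrightarrow> S \<subseteq> topspace T \<and> meager_in T (topspace T - S)"

end

theory Submission
  imports Defs
begin

text \<open>
  Consider the metrics that have, uniformly in the base point, a gap of some fixed width
  \<open>\<delta>\<close> below \<open>1/(n+1)\<close>. They form an open set, and a metric lying in all of these sets is
  gap-like. For density, strong zero-dimensionality and Stone's \<open>\<sigma>\<close>-discrete refinement of
  a cover by balls give a locally constant map \<open>q\<close> that moves points by less than \<open>h/4\<close>.
  Keeping \<open>d\<close> inside the fibres of \<open>q\<close> and rounding \<open>d (q x) (q y)\<close> up to a multiple of
  \<open>h\<close> across fibres yields a compatible metric uniformly close to \<open>d\<close> that takes no value
  in the interval from \<open>h/2\<close> to \<open>h\<close>.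
\<close>

section \<open>Locally constant approximation of the identity\<close>

lemma (in Metric_space) locally_constant_approximation:
  assumes zd: "strongly_zero_dimensional mtopology" and "0 < r"
  obtains q where "q \<in> M \<rightarrow> M" "\<And>x. x \<in> M \<Longrightarrow> d x (q x) < r"
    "\<And>c. openin mtopology {x \<in> M. q x = c}"
proof -
  \<comment> \<open>The order serves to compare centres of balls. Elements outside \<open>M\<close>
    do no harm, since balls around them are empty.\<close>
  obtain R :: "'a rel" where R: "well_order_on UNIV R"
    using well_order_on by blast
  then have wf: "wf (R - Id)" and tot: "total R"
    by (auto simp: well_order_on_def linear_order_on_def)
  define \<epsilon> where "\<epsilon> n = 1 / real (Suc n)" for n
  have \<epsilon>: "\<epsilon> n > 0" for n by (simp add: \<epsilon>_def)
  \<comment> \<open>Stone's construction: points that lie in no ball of an earlier centre and have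
    room \<open>\<epsilon> n\<close> inside the ball of \<open>c\<close>.\<close>
  define S where "S c n = {y \<in> mball c r. mball y (\<epsilon> n) \<subseteq> mball c r \<and>
      (\<forall>z. (z, c) \<in> R - Id \<longrightarrow> y \<notin> mball z r)}" for c n
  define W where "W c n = (\<Union>s \<in> S c n. mball s (\<epsilon> n / 3))" for c n
  have SM: "S c n \<subseteq> M" for c n by (auto simp: S_def)
  have Wopen: "openin mtopology (W c n)" for c n
    unfolding W_def by blast
  have Wball: "W c n \<subseteq> mball c r" for c n
  proof -
    have "mball s (\<epsilon> n / 3) \<subseteq> mball s (\<epsilon> n)" for s
      by (rule mball_subset_concentric) (use \<epsilon>[of n] in simp)
    then show ?thesis unfolding W_def S_def by blast
  qed
  \<comment> \<open>The point \<open>t\<close> avoids the ball of the earlier centre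
    \<open>c\<close>, which contains all of \<open>mball s (\<epsilon> n)\<close>.\<close>
  have sep0: "\<epsilon> n \<le> d s t" if "(c, c') \<in> R - Id" "s \<in> S c n" "t \<in> S c' n" for c c' s t n
  proof (rule ccontr)
    assume "\<not> ?thesis"
    then have "t \<in> mball s (\<epsilon> n)" using that SM by (auto simp: subset_iff)
    then show False using that unfolding S_def by auto
  qed
  have sep: "\<epsilon> n \<le> d s t" if "c \<noteq> c'" "s \<in> S c n" "t \<in> S c' n" for c c' s t n
  proof -
    have "(c, c') \<in> R - Id \<or> (c', c) \<in> R - Id"
      using tot that(1) by (auto simp: total_on_def)
    then show ?thesis using sep0 that commute by metis
  qed
  \<comment> \<open>A common point would bring two centres from different \<open>S c n\<close>
    within two thirds of \<open>\<epsilon> n\<close>.\<close>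
  have Wdisj: "c = c'" if y: "y \<in> W c n" "y \<in> W c' n" for c c' y n
  proof (rule ccontr)
    assume ne: "c \<noteq> c'"
    obtain s t where st: "s \<in> S c n" "t \<in> S c' n" "y \<in> mball s (\<epsilon> n / 3)" "y \<in> mball t (\<epsilon> n / 3)"
      using y unfolding W_def by blast
    then have "d s t \<le> d s y + d t y"
      using triangle'[of s y t] triangle[of s y t] by (auto simp: commute)
    then have "d s t < \<epsilon> n" using st(3,4) \<epsilon>[of n] by auto
    then show False using sep[OF ne st(1,2)] by simp
  qed
  \<comment> \<open>Strong zero-dimensionality enters here: it inserts a clopen \<open>V n\<close>
    between the closure of the union of the \<open>S c n\<close> and the open union of the
    \<open>W c n\<close>.\<close>
  have "\<exists>V. openin mtopology V \<and> closedin mtopology V \<and>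
      mtopology closure_of (\<Union>c. S c n) \<subseteq> V \<and> V \<inter> (M - (\<Union>c. W c n)) = {}" for n
  proof (rule zd[unfolded strongly_zero_dimensional_def, rule_format], intro conjI)
    show "closedin mtopology (M - (\<Union>c. W c n))"
      using openin_Union[of "range (\<lambda>c. W c n)" mtopology] Wopen
      by (auto simp: closedin_def Diff_Diff_Int inf.absorb2 openin_subset)
    show "mtopology closure_of (\<Union>c. S c n) \<inter> (M - (\<Union>c. W c n)) = {}"
    proof -
      have "y \<in> (\<Union>c. W c n)" if y: "y \<in> mtopology closure_of (\<Union>c. S c n)" for y
      proof -
        have "\<epsilon> n / 3 > 0" using \<epsilon>[of n] by simp
        then obtain s c where "s \<in> S c n" "s \<in> mball y (\<epsilon> n / 3)"
          using y unfolding metric_closure_of by blast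
        then have "y \<in> W c n" unfolding W_def by (auto simp: commute intro!: bexI[of _ s])
        then show ?thesis by blast
      qed
      then show ?thesis by blast
    qed
  qed simp
  then obtain V where V: "\<And>n. openin mtopology (V n)" "\<And>n. closedin mtopology (V n)"
      "\<And>n. mtopology closure_of (\<Union>c. S c n) \<subseteq> V n" "\<And>n. V n \<inter> (M - (\<Union>c. W c n)) = {}"
    by metis
  have VW: "\<exists>c. y \<in> W c n" if "y \<in> V n" for y n
    using V(4)[of n] openin_subset[OF V(1)[of n]] that by auto
  have SV: "S c n \<subseteq> V n" for c n
    using V(3)[of n] closure_of_subset[of "\<Union>c. S c n" mtopology] SM by fastforce
  have cover: "\<exists>n. y \<in> V n" if y: "y \<in> M" for y
  proof -
    have "y \<in> mball y r" using y \<open>0 < r\<close> by simp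
    \<comment> \<open>With the earliest centre whose ball contains \<open>y\<close>, the point lies
      in \<open>S c n\<close> as soon as \<open>\<epsilon> n\<close> is small enough.\<close>
    then obtain c where c: "y \<in> mball c r" "\<And>z. (z, c) \<in> R - Id \<Longrightarrow> y \<notin> mball z r"
      using wfE_min[OF wf, of y "{c. y \<in> mball c r}"] unfolding mem_Collect_eq by metis
    obtain \<rho> where \<rho>: "\<rho> > 0" "mball y \<rho> \<subseteq> mball c r"
      using c(1) openin_mball[of c r] unfolding openin_mtopology by blast
    obtain n where "\<epsilon> n < \<rho>" using \<rho>(1) reals_Archimedean unfolding \<epsilon>_def
      by (metis inverse_eq_divide)
    then have "mball y (\<epsilon> n) \<subseteq> mball c r"
      using \<rho>(2) mball_subset_concentric[of "\<epsilon> n" \<rho> y] by auto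
    then have "y \<in> S c n" using c unfolding S_def by auto
    then show ?thesis using SV by blast
  qed
  \<comment> \<open>The first clopen set containing \<open>y\<close> fixes a level, and at that
    level disjointness leaves just one centre. Only finitely many closed sets are removed from
    \<open>V n\<close>, so the fibres of \<open>q\<close> are open.\<close>
  define N where "N y = (LEAST n. y \<in> V n)" for y
  define q where "q y = (THE c. y \<in> W c (N y))" for y
  have NV: "y \<in> V (N y)" if "y \<in> M" for y
    unfolding N_def using cover[OF that] by (rule LeastI_ex)
  have q: "y \<in> W (q y) (N y)" if "y \<in> M" for y
    unfolding q_def by (rule theI') (use VW[OF NV[OF that]] Wdisj in blast)
  have qball: "y \<in> mball (q y) r" if "y \<in> M" for y
    using q[OF that] Wball by blast
  have fibre: "{x \<in> M. q x = c} = (\<Union>n. (V n - (\<Union>m<n. V m)) \<inter> W c n)" for c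
  proof (intro equalityI subsetI)
    fix x assume "x \<in> {x \<in> M. q x = c}"
    then have "x \<in> V (N x)" "x \<in> W c (N x)" using NV q by auto
    moreover have "x \<notin> V m" if "m < N x" for m
      using that not_less_Least unfolding N_def by blast
    ultimately show "x \<in> (\<Union>n. (V n - (\<Union>m<n. V m)) \<inter> W c n)" by blast
  next
    fix x assume "x \<in> (\<Union>n. (V n - (\<Union>m<n. V m)) \<inter> W c n)"
    then obtain n where n: "x \<in> V n" "\<And>m. m < n \<Longrightarrow> x \<notin> V m" "x \<in> W c n" by blast
    have "N x = n" unfolding N_def
      by (rule Least_equality) (use n in \<open>auto simp: not_less[symmetric]\<close>)
    moreover have "x \<in> M" using n(3) Wball by fastforce
    ultimately show "x \<in> {x \<in> M. q x = c}" using q[of x] n(3) Wdisj by auto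
  qed
  show thesis
  proof (rule that)
    show "q \<in> M \<rightarrow> M" using qball by fastforce
    show "d x (q x) < r" if "x \<in> M" for x using qball[OF that] by (auto simp: commute)
    show "openin mtopology {x \<in> M. q x = c}" for c
    proof -
      have "closedin mtopology (\<Union>m<n. V m)" for n
        by (rule closedin_Union) (use V(2) in auto)
      then have "openin mtopology ((V n - (\<Union>m<n. V m)) \<inter> W c n)" for n
        using V(1) Wopen by blast
      then show ?thesis unfolding fibre by blast
    qed
  qed
qed

section \<open>Rounding a metric across the fibres\<close>

text \<open>Subadditivity of the ceiling is the reason for rounding up: it preserves the triangle
  inequality, which rounding to the nearest multiple may break.\<close>

lemma mult_ceiling_add_le:
  fixes h a b c :: real
  assumes "0 < h" "a \<le> b + c"
  shows "h * \<lceil>a / h\<rceil> \<le> h * \<lceil>b / h\<rceil> + h * \<lceil>c / h\<rceil>"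
proof -
  have "\<lceil>a / h\<rceil> \<le> \<lceil>b / h\<rceil> + \<lceil>c / h\<rceil>"
  proof (rule order.trans)
    show "\<lceil>a / h\<rceil> \<le> \<lceil>b / h + c / h\<rceil>"
      using assms by (intro ceiling_mono) (simp add: divide_simps)
  qed (rule ceiling_add_le)
  then have "h * \<lceil>a / h\<rceil> \<le> h * of_int (\<lceil>b / h\<rceil> + \<lceil>c / h\<rceil>)"
    using assms(1) by (intro mult_left_mono) (auto simp only: of_int_le_iff less_imp_le)
  then show ?thesis by (simp add: distrib_left)
qed

text \<open>The value \<open>0\<close> off \<open>M\<close> is the convention required by
  \<open>Met\<close>.\<close>

definition gap_rounding where
  "gap_rounding M d h q x y =
     (if x \<notin> M \<or> y \<notin> M then 0
      else if q x = q y then d x y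
      else h * \<lceil>d (q x) (q y) / h\<rceil>)" for h :: real

text \<open>Two points of one fibre are within \<open>h / 4\<close> of their common image, hence
  less than \<open>h / 2\<close> apart; across fibres the new distance is a positive multiple of
  \<open>h\<close>. This gives the gap. The topology is unchanged because both metrics agree on the
  open fibres and new balls of radius at most \<open>h\<close> stay inside a fibre.\<close>

lemma (in Metric_space)
  assumes h: "0 < h" and qM: "q \<in> M \<rightarrow> M" and qd: "\<And>x. x \<in> M \<Longrightarrow> d x (q x) < h / 4"
    and qopen: "\<And>c. openin mtopology {x \<in> M. q x = c}"
  shows Metric_space_gap_rounding: "Metric_space M (gap_rounding M d h q)"
    and mtopology_gap_rounding: "Metric_space.mtopology M (gap_rounding M d h q) = mtopology"
    and gap_rounding_avoids: "gap_rounding M d h q x y \<notin> {h / 2<..<h}"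
    and gap_rounding_close: "x \<in> M \<Longrightarrow> y \<in> M \<Longrightarrow> \<bar>d x y - gap_rounding M d h q x y\<bar> \<le> 2 * h"
proof -
  let ?e = "gap_rounding M d h q"
  have qin: "q x \<in> M" if "x \<in> M" for x using qM that by blast
  have same: "?e x y = d x y" "?e x y < h / 2" if "x \<in> M" "y \<in> M" "q x = q y" for x y
  proof -
    show "?e x y = d x y" using that by (simp add: gap_rounding_def)
    moreover have "d x y \<le> d x (q x) + d y (q y)"
      using triangle[of x "q x" y] that qin by (simp add: commute)
    ultimately show "?e x y < h / 2" using qd[OF that(1)] qd[OF that(2)] by linarith
  qed
  have diff: "?e x y = h * \<lceil>d (q x) (q y) / h\<rceil>" "h \<le> ?e x y"
    if "x \<in> M" "y \<in> M" "q x \<noteq> q y" for x y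
  proof -
    show eq: "?e x y = h * \<lceil>d (q x) (q y) / h\<rceil>" using that by (simp add: gap_rounding_def)
    have "0 < d (q x) (q y)" using that qin by simp
    then have "1 \<le> \<lceil>d (q x) (q y) / h\<rceil>" using h by simp
    then show "h \<le> ?e x y" using h unfolding eq by simp
  qed
  have tri: "?e x z \<le> ?e x y + ?e y z" if "x \<in> M" "y \<in> M" "z \<in> M" for x y z
  proof -
    \<comment> \<open>Points of one fibre have equal new distances to any point outside it. If only
      \<open>y\<close> leaves the fibre of \<open>x\<close> and \<open>z\<close>, the left side is
      below \<open>h / 2\<close> and the right side is at least \<open>2 * h\<close>.\<close>
    consider "q x = q y" "q y = q z" | "q x = q y" "q y \<noteq> q z" | "q x \<noteq> q y" "q y = q z"
      | "q x \<noteq> q y" "q y \<noteq> q z" "q x = q z" | "q x \<noteq> q y" "q y \<noteq> q z" "q x \<noteq> q z" by blast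
    then show ?thesis
    proof cases
      case 1 then show ?thesis using that same triangle by auto
    next
      case 2 then show ?thesis using that by (simp add: gap_rounding_def)
    next
      case 3 then show ?thesis using that by (simp add: gap_rounding_def)
    next
      case 4 then show ?thesis
        using that same(2)[of x z] diff(2)[of x y] diff(2)[of y z] h by simp
    next
      case 5 then show ?thesis
        using that mult_ceiling_add_le[OF h triangle[of "q x" "q y" "q z"]] qin
        by (simp add: diff(1))
    qed
  qed
  show ms: "Metric_space M ?e"
  proof
    show "0 \<le> ?e x y" for x y
      using diff(2)[of x y] h by (cases "x \<in> M \<and> y \<in> M \<and> q x \<noteq> q y") (auto simp: gap_rounding_def)
    show "?e x y = ?e y x" for x y by (auto simp: gap_rounding_def commute)
    show "(?e x y = 0) = (x = y)" if "x \<in> M" "y \<in> M" for x y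
      using that same(1)[of x y] diff(2)[of x y] h by (cases "q x = q y") auto
  qed (fact tri)
  interpret e: Metric_space M ?e by (fact ms)
  show "e.mtopology = mtopology"
  proof (rule topology_eq[THEN iffD2], intro allI iffI)
    fix U assume U: "openin e.mtopology U"
    show "openin mtopology U"
    proof (subst openin_subopen, intro ballI)
      fix x assume x: "x \<in> U"
      then have xM: "x \<in> M" using openin_subset[OF U] by auto
      obtain r where r: "r > 0" "e.mball x r \<subseteq> U"
        using U x unfolding e.openin_mtopology by blast
      have "mball x r \<inter> {y \<in> M. q y = q x} \<subseteq> U"
        using r(2) same(1)[OF xM] by fastforce
      moreover have "x \<in> mball x r \<inter> {y \<in> M. q y = q x}" using xM r(1) by simp
      ultimately show "\<exists>T. openin mtopology T \<and> x \<in> T \<and> T \<subseteq> U"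
        using qopen openin_Int[OF openin_mball] by blast
    qed
  next
    fix U assume U: "openin mtopology U"
    show "openin e.mtopology U" unfolding e.openin_mtopology
    proof (intro conjI allI impI)
      show "U \<subseteq> M" using openin_subset[OF U] by simp
      fix x assume x: "x \<in> U"
      then have xM: "x \<in> M" using \<open>U \<subseteq> M\<close> by auto
      obtain r where r: "r > 0" "mball x r \<subseteq> U"
        using U x unfolding openin_mtopology by blast
      have "e.mball x (min r h) \<subseteq> U"
      proof
        fix y assume "y \<in> e.mball x (min r h)"
        then have y: "y \<in> M" "?e x y < r" "?e x y < h" by auto
        then have "q x = q y" using diff(2)[OF xM y(1)] by fastforce
        then show "y \<in> U" using y same(1)[OF xM y(1)] r(2) xM by auto
      qed
      then show "\<exists>r>0. e.mball x r \<subseteq> U" using r(1) h by (intro exI[of _ "min r h"]) auto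
    qed
  qed
  show "?e x y \<notin> {h / 2<..<h}"
    using same(2)[of x y] diff(2)[of x y] h
    by (cases "x \<in> M \<and> y \<in> M") (cases "q x = q y", auto simp: gap_rounding_def)
  show "\<bar>d x y - ?e x y\<bar> \<le> 2 * h" if xy: "x \<in> M" "y \<in> M"
  proof (cases "q x = q y")
    case True then show ?thesis using xy same(1) h by simp
  next
    case False
    \<comment> \<open>Rounding costs at most \<open>h\<close>, and replacing \<open>x\<close>,
      \<open>y\<close> by their images costs less than \<open>h / 2\<close>.\<close>
    have "d (q x) (q y) / h \<le> \<lceil>d (q x) (q y) / h\<rceil>" "\<lceil>d (q x) (q y) / h\<rceil> \<le> d (q x) (q y) / h + 1"
      by linarith+
    from this[THEN mult_left_mono[of _ _ h]] have "d (q x) (q y) \<le> ?e x y"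
        "?e x y \<le> d (q x) (q y) + h"
      using h unfolding diff(1)[OF xy False] by (simp_all add: distrib_left)
    moreover have "d x y \<le> d x (q x) + d (q x) (q y) + d y (q y)"
      using triangle[of x "q x" y] triangle[of "q x" "q y" y] xy qin by (simp add: commute)
    moreover have "d (q x) (q y) \<le> d x (q x) + d x y + d y (q y)"
      using triangle[of "q x" x "q y"] triangle[of x y "q y"] xy qin by (simp add: commute)
    ultimately show ?thesis using qd[OF xy(1)] qd[OF xy(2)] h by linarith
  qed
qed

section \<open>The topology of uniform distance on metrics\<close>

lemma Met_dist_triangle: "Met_dist X d f \<le> Met_dist X d e + Met_dist X e f"
proof -
  have "ennreal \<bar>d x y - f x y\<bar> \<le> Met_dist X d e + Met_dist X e f"
    if "(x, y) \<in> topspace X \<times> topspace X" for x y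
  proof -
    have "ennreal \<bar>d x y - f x y\<bar> \<le> ennreal \<bar>d x y - e x y\<bar> + ennreal \<bar>e x y - f x y\<bar>"
      by (subst ennreal_plus[symmetric]) (auto intro!: ennreal_leI simp del: ennreal_plus)
    also have "\<dots> \<le> Met_dist X d e + Met_dist X e f"
      unfolding Met_dist_def using that by (intro add_mono) (auto intro: SUP_upper2)
    finally show ?thesis .
  qed
  then show ?thesis unfolding Met_dist_def[of X d f] by (intro SUP_least) auto
qed

lemma Met_dist_refl [simp]: "Met_dist X d d = 0"
proof -
  have "Met_dist X d d \<le> 0"
    unfolding Met_dist_def by (rule SUP_least) auto
  then show ?thesis by simp
qed

lemma Met_dist_lessD:
  assumes "Met_dist X d e < ennreal r" "x \<in> topspace X" "y \<in> topspace X"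
  shows "\<bar>d x y - e x y\<bar> < r"
proof -
  have "ennreal \<bar>d x y - e x y\<bar> \<le> Met_dist X d e"
    unfolding Met_dist_def using assms by (auto intro: SUP_upper2)
  then show ?thesis using assms(1) by (metis abs_ge_zero ennreal_less_iff order.strict_trans1)
qed

lemma openin_Met_ball:
  assumes "d \<in> Met X" "0 < r"
  shows "openin (Met_topology X) {e \<in> Met X. Met_dist X d e < r}"
  unfolding Met_topology_def by (rule topology_generated_by_Basis) (use assms in auto)

text \<open>Balls are given only as a subbase, so induction over the generation of \<open>U\<close>
  is needed to see that balls centred at \<open>d\<close> form a neighborhood base.\<close>

lemma Met_ball_subset_open:
  assumes "openin (Met_topology X) U" "d \<in> U"
  obtains r where "0 < r" "{e \<in> Met X. Met_dist X d e < r} \<subseteq> U"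
proof -
  have "generate_topology_on {{e \<in> Met X. Met_dist X d e < r} | d r. d \<in> Met X \<and> 0 < r} U"
    using assms(1) unfolding Met_topology_def openin_topology_generated_by_iff .
  then have "d \<in> U \<longrightarrow> (\<exists>r>0. {e \<in> Met X. Met_dist X d e < r} \<subseteq> U)"
  proof (induction rule: generate_topology_on.induct)
    case (Int a b)
    show ?case
    proof
      assume "d \<in> a \<inter> b"
      then obtain r s where "r > 0" "{e \<in> Met X. Met_dist X d e < r} \<subseteq> a"
        "s > 0" "{e \<in> Met X. Met_dist X d e < s} \<subseteq> b" using Int by blast
      then show "\<exists>r>0. {e \<in> Met X. Met_dist X d e < r} \<subseteq> a \<inter> b"
        by (intro exI[of _ "min r s"]) auto
    qed
  next
    case (Basis s)
    then obtain c r where s: "s = {e \<in> Met X. Met_dist X c e < r}" by blast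
    show ?case
    proof
      assume "d \<in> s"
      then have lt: "Met_dist X c d < r" by (simp add: s)
      \<comment> \<open>The radius \<open>r\<close> may be infinite, but
        \<open>Met_dist X c d\<close> is finite, being less than \<open>r\<close>.\<close>
      then have "0 < r - Met_dist X c d" by (simp add: diff_gr0_ennreal)
      moreover have "Met_dist X c e < r" if "Met_dist X d e < r - Met_dist X c d" for e
        using that lt Met_dist_triangle[of X c e d]
        by (metis add.commute less_diff_eq_ennreal order.strict_trans1 top.not_eq_extremum)
      ultimately show "\<exists>r>0. {e \<in> Met X. Met_dist X d e < r} \<subseteq> s"
        unfolding s by blast
    qed
  qed blast+
  then show thesis using assms(2) that by blast
qed

section \<open>Metrics with uniform gaps: openness and density\<close>

text \<open>The width \<open>\<delta>\<close> is chosen before \<open>p\<close>, which makes the set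
  open; the position \<open>a\<close> of the gap may vary with \<open>p\<close>.\<close>

definition uniform_gap :: "'a topology \<Rightarrow> real \<Rightarrow> ('a \<Rightarrow> 'a \<Rightarrow> real) set" where
  "uniform_gap X t = {d \<in> Met X. \<exists>\<delta>>0. \<forall>p \<in> topspace X. \<exists>a\<ge>0. a + \<delta> \<le> t \<and>
     (\<forall>x \<in> topspace X. d p x \<notin> {a<..<a + \<delta>})}"

text \<open>Changing all distances by less than \<open>\<delta> / 3\<close> leaves the middle third
  of each gap free of values.\<close>

lemma openin_uniform_gap: "openin (Met_topology X) (uniform_gap X t)"
proof (subst openin_subopen, intro ballI)
  fix d assume "d \<in> uniform_gap X t"
  then obtain \<delta> where d: "d \<in> Met X" "\<delta> > 0" and gap: "\<And>p. p \<in> topspace X \<Longrightarrow>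
      \<exists>a\<ge>0. a + \<delta> \<le> t \<and> (\<forall>x \<in> topspace X. d p x \<notin> {a<..<a + \<delta>})"
    unfolding uniform_gap_def by blast
  let ?B = "{e \<in> Met X. Met_dist X d e < ennreal (\<delta> / 3)}"
  have "?B \<subseteq> uniform_gap X t"
  proof
    fix e assume e: "e \<in> ?B"
    have "\<exists>a\<ge>0. a + \<delta> / 3 \<le> t \<and> (\<forall>x \<in> topspace X. e p x \<notin> {a<..<a + \<delta> / 3})"
      if p: "p \<in> topspace X" for p
    proof -
      obtain a where a: "a \<ge> 0" "a + \<delta> \<le> t" "\<And>x. x \<in> topspace X \<Longrightarrow> d p x \<notin> {a<..<a + \<delta>}"
        using gap[OF p] by blast
      have "e p x \<notin> {a + \<delta> / 3<..<a + \<delta> / 3 + \<delta> / 3}" if x: "x \<in> topspace X" for x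
        using Met_dist_lessD[of X d e "\<delta> / 3" p x] e p x a(3)[OF x] by auto
      then show ?thesis using a d by (intro exI[of _ "a + \<delta> / 3"]) auto
    qed
    then show "e \<in> uniform_gap X t"
      using e d(2) unfolding uniform_gap_def mem_Collect_eq
      by (metis divide_pos_pos zero_less_numeral)
  qed
  moreover have "openin (Met_topology X) ?B" using d by (intro openin_Met_ball) auto
  ultimately show "\<exists>T. openin (Met_topology X) T \<and> d \<in> T \<and> T \<subseteq> uniform_gap X t"
    using d by (intro exI[of _ ?B]) auto
qed

lemma uniform_gap_approx:
  assumes zd: "strongly_zero_dimensional X" and d: "d \<in> Met X" and "0 < t" "0 < r"
  shows "\<exists>e \<in> uniform_gap X t. Met_dist X d e < r"
proof -
  interpret Metric_space "topspace X" d using d by (simp add: Met_def)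
  have top: "mtopology = X" using d by (simp add: Met_def)
  \<comment> \<open>A real \<open>s\<close> replaces \<open>r\<close>, which may be
    infinite.\<close>
  obtain s where s: "0 < ennreal s" "ennreal s < r"
    using \<open>0 < r\<close> by (metis dense ennreal_cases top.extremum_strict not_less_iff_gr_or_eq)
  then have s0: "0 < s" by simp
  \<comment> \<open>The bound by \<open>t\<close> puts the gap from \<open>h / 2\<close> to
    \<open>h\<close> below \<open>t\<close>; the bound by \<open>s / 2\<close> keeps the error
    \<open>2 * h\<close> at most \<open>s\<close>.\<close>
  define h where "h = min t (s / 2)"
  have h: "0 < h" "h \<le> t" "2 * h \<le> s" using s0 \<open>0 < t\<close> by (auto simp: h_def)
  obtain q where q: "q \<in> topspace X \<rightarrow> topspace X" "\<And>x. x \<in> topspace X \<Longrightarrow> d x (q x) < h / 4"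
    "\<And>c. openin mtopology {x \<in> topspace X. q x = c}"
    using locally_constant_approximation[of "h / 4"] zd h(1) unfolding top by auto
  let ?e = "gap_rounding (topspace X) d h q"
  have "?e \<in> Met X"
    using Metric_space_gap_rounding[OF h(1) q] mtopology_gap_rounding[OF h(1) q] top
    by (auto simp: Met_def gap_rounding_def)
  then have "?e \<in> uniform_gap X t"
    using gap_rounding_avoids[OF h(1) q] h(1,2)
    unfolding uniform_gap_def by (auto intro!: exI[of _ "h / 2"])
  moreover have "Met_dist X d ?e \<le> ennreal s"
    unfolding Met_dist_def
    using gap_rounding_close[OF h(1) q] h(3) by (intro SUP_least) (force intro!: ennreal_leI)
  ultimately show ?thesis using s(2) by (meson order.strict_trans1)
qed

text \<open>The set is closed, so it suffices that it contains no ball; every ball meets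
  \<open>uniform_gap X t\<close> by approximation.\<close>

lemma nowhere_dense_uniform_gap:
  assumes "strongly_zero_dimensional X" "0 < t"
  shows "nowhere_dense_in (Met_topology X) (Met X - uniform_gap X t)"
proof -
  have "closedin (Met_topology X) (Met X - uniform_gap X t)"
    using openin_uniform_gap by (metis closedin_diff closedin_topspace topspace_Met_topology)
  then have "Met_topology X interior_of (Met_topology X closure_of (Met X - uniform_gap X t)) =
      Met_topology X interior_of (Met X - uniform_gap X t)"
    by (simp add: closure_of_closedin)
  also have "\<dots> = {}"
  proof (rule ccontr)
    assume "\<not> ?thesis"
    then obtain d where d: "d \<in> Met_topology X interior_of (Met X - uniform_gap X t)" by blast
    obtain r where "0 < r"
      "{e \<in> Met X. Met_dist X d e < r} \<subseteq> Met_topology X interior_of (Met X - uniform_gap X t)"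
      using Met_ball_subset_open[OF openin_interior_of d] .
    then have r: "0 < r" "{e \<in> Met X. Met_dist X d e < r} \<subseteq> Met X - uniform_gap X t"
      using order.trans[OF _ interior_of_subset] by blast+
    have "d \<in> Met X" using subsetD[OF interior_of_subset d] by simp
    then obtain e where "e \<in> uniform_gap X t" "Met_dist X d e < r"
      using uniform_gap_approx assms r(1) by blast
    then show False using r(2) unfolding uniform_gap_def by blast
  qed
  finally show ?thesis by (simp add: nowhere_dense_in_def topspace_Met_topology)
qed

lemma nowhere_dense_in_subset:
  assumes "nowhere_dense_in T S" "R \<subseteq> S"
  shows "nowhere_dense_in T R"
  using assms interior_of_mono[OF closure_of_mono[OF assms(2), of T], of T]
  unfolding nowhere_dense_in_def by auto

section \<open>Gap-like metrics and comeagerness\<close>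

text \<open>For large \<open>n\<close> a neighborhood of \<open>0\<close> contains the whole gap
  below \<open>1 / real (Suc n)\<close>. The midpoint of that gap then lies in the neighborhood but
  not in the closure of the set of distances.\<close>

lemma gap_like_if_uniform_gaps:
  assumes d: "\<And>n. d \<in> uniform_gap X (1 / real (Suc n))"
  shows "gap_like X d"
  unfolding gap_like_def
proof (intro ballI allI impI notI)
  fix p U assume p: "p \<in> topspace X" and "nbhd_in (top_of_set {0..}) (0::real) U"
    and dense: "dense_within (top_of_set {0..}) {d p x |x. x \<in> topspace X} U"
  then obtain W where W: "openin (top_of_set {0..}) W" "0 \<in> W" "W \<subseteq> U"
    unfolding nbhd_in_def by blast
  then obtain \<epsilon> where \<epsilon>: "\<epsilon> > 0" "\<And>u. 0 \<le> u \<Longrightarrow> u < \<epsilon> \<Longrightarrow> u \<in> W"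
    unfolding openin_euclidean_subtopology_iff by (fastforce simp: dist_real_def)
  obtain n where n: "1 / real (Suc n) < \<epsilon>" using \<epsilon>(1) reals_Archimedean
    by (metis inverse_eq_divide)
  obtain \<delta> a where a: "\<delta> > 0" "a \<ge> 0" "a + \<delta> \<le> 1 / real (Suc n)"
    "\<And>x. x \<in> topspace X \<Longrightarrow> d p x \<notin> {a<..<a + \<delta>}"
    using d[of n] p unfolding uniform_gap_def by blast
  have "a + \<delta> / 2 \<in> U" using \<epsilon>(2)[of "a + \<delta> / 2"] W(3) a n by auto
  then have "a + \<delta> / 2 \<in> top_of_set {0..} closure_of ({d p x |x. x \<in> topspace X} \<inter> U)"
    using dense unfolding dense_within_def by blast
  moreover have "openin (top_of_set {0..}) ({0..} \<inter> {a<..<a + \<delta>})"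
    by (rule openin_open_Int) simp
  moreover have "a + \<delta> / 2 \<in> {0..} \<inter> {a<..<a + \<delta>}" using a by simp
  ultimately have "\<exists>u. u \<in> {d p x |x. x \<in> topspace X} \<inter> U \<and> u \<in> {0..} \<inter> {a<..<a + \<delta>}"
    unfolding in_closure_of by (elim conjE allE[of _ "{0..} \<inter> {a<..<a + \<delta>}"]) simp
  then show False using a(4) by blast
qed

theorem theorem1p2:
  fixes X :: "'a topology"
  assumes "metrizable_space X" and "strongly_zero_dimensional X"
  shows "comeager_in (Met_topology X) (GL X)"
proof -
  \<comment> \<open>Since \<open>meager_in\<close> asks for equality with a union, the complements
    of the \<open>uniform_gap\<close> sets are cut down to \<open>Met X - GL X\<close>.\<close>
  let ?F = "\<lambda>n. Met X - GL X - uniform_gap X (1 / real (Suc n))"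
  have "nowhere_dense_in (Met_topology X) (?F n)" for n
    by (rule nowhere_dense_in_subset[OF nowhere_dense_uniform_gap[OF assms(2)]]) auto
  moreover have "Met X - GL X = (\<Union>n. ?F n)"
    using gap_like_if_uniform_gaps unfolding GL_def by blast
  ultimately have "meager_in (Met_topology X) (Met X - GL X)"
    unfolding meager_in_def by (intro exI[of _ "range ?F"]) auto
  then show ?thesis
    by (auto simp: comeager_in_def topspace_Met_topology GL_def)
qed

end
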